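(* Let $q$ be a prime power. For integers $0<\rho<n\le m$ and $0\le l\le \lfloor\log_{q^m}K_R(q^m,n,\rho)\rfloor$, $$K_R(q^m,n,\rho)\ge \frac{q^{mn}-q^{lm}I(\rho,n-l)+\sum_{a=\max\{1,n-2\rho+1\}}^{l}(q^{am}-q^{(a-1)m})\,I(\rho,n-a+1)}{v(\rho)-I(\rho,n-l)}.$$
   Context: For $\mathbf{x}\in \mathrm{GF}(q^m)^n$, $\mathrm{rk}(\mathbf{x})$ is the maximum number of coordinates of $\mathbf{x}$ that are linearly independent over $\mathrm{GF}(q)$; the rank distance is $d_R(\mathbf{x},\mathbf{y})=\mathrm{rk}(\mathbf{x}-\mathbf{y})$. $v(\rho)$ is the number of vectors in a ball of rank radius $\rho$ in $\mathrm{GF}(q^m)^n$. For $0\le d\le n$, $I(\rho,d)$ is the number of vectors in the intersection of two balls of rank radius $\rho$ in $\mathrm{GF}(q^m)^n$ whose centers are at rank distance $d$ (this depends only on $d$ and not on the particular centers). The rank covering radius of a nonempty code $C\subseteq \mathrm{GF}(q^m)^n$ is $\max_{\mathbf{x}}\min_{\mathbf{c}\in C} d_R(\mathbf{x},\mathbf{c})$. $K_R(q^m,n,\rho)$ denotes the minimum number of balls of rank radius $\rho$ needed to cover $\mathrm{GF}(q^m)^n$, i.e. the minimum cardinality of a (not necessarily linear) code $C\subseteq\mathrm{GF}(q^m)^n$ with rank covering radius at most $\rho$. Empty sums are zero. *)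

theory Defs
  imports "HOL-Analysis.Analysis" "HOL-Number_Theory.Prime_Powers"
begin

text \<open>
  The inclusion of GF(q) into GF(q^m) is an embedding \<open>\<iota>\<close> of a finite field
  \<open>'k\<close> into a finite field \<open>'a\<close>. Since \<open>'a\<close> has a unique subfield with \<open>q\<close>
  elements, the image of \<open>\<iota>\<close> is determined by \<open>CARD('k) = q\<close>.
\<close>

definition field_embedding :: "('k::field \<Rightarrow> 'a::field) \<Rightarrow> bool" where
  "field_embedding \<iota> \<longleftrightarrow>
     \<iota> 1 = 1 \<and> (\<forall>a b. \<iota> (a + b) = \<iota> a + \<iota> b) \<and> (\<forall>a b. \<iota> (a * b) = \<iota> a * \<iota> b)"

abbreviation (input) scale_by :: "('k::field \<Rightarrow> 'a::field) \<Rightarrow> 'k \<Rightarrow> 'a \<Rightarrow> 'a" where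
  "scale_by \<iota> \<equiv> (\<lambda>c x. \<iota> c * x)"

lemma vector_space_scale_by:
  assumes "field_embedding \<iota>"
  shows "vector_space (scale_by \<iota>)"
  using assms unfolding field_embedding_def
  by unfold_locales (auto simp: algebra_simps)

text \<open>
  A linearly independent family of coordinates has pairwise distinct members, so
  it suffices to range over sets of coordinate values.
\<close>

definition rk :: "('k::field \<Rightarrow> 'a::field) \<Rightarrow> 'a ^ 'n::finite \<Rightarrow> nat" where
  "rk \<iota> x = Max {card B | B. B \<subseteq> range (\<lambda>i. x $ i) \<and> module.independent (scale_by \<iota>) B}"

definition rank_dist :: "('k::field \<Rightarrow> 'a::field) \<Rightarrow> 'a ^ 'n::finite \<Rightarrow> 'a ^ 'n \<Rightarrow> nat" where
  "rank_dist \<iota> x y = rk \<iota> (x - y)"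

definition rank_ball :: "('k::field \<Rightarrow> 'a::field) \<Rightarrow> 'a ^ 'n::finite \<Rightarrow> nat \<Rightarrow> ('a ^ 'n) set" where
  "rank_ball \<iota> c \<rho> = {x. rank_dist \<iota> x c \<le> \<rho>}"

text \<open>
  The next three numbers depend on the length \<open>CARD('n)\<close>, which is passed as a type
  argument. A ball can be centred at the origin because the metric is translation
  invariant. The cardinality in \<open>ball_inter_vol\<close> depends only on the distance \<open>d\<close>
  of the centres, and the description has a unique solution whenever some pair of
  centres is at distance \<open>d\<close>.
\<close>

definition ball_vol :: "('k::field \<Rightarrow> 'a::field) \<Rightarrow> 'n::finite itself \<Rightarrow> nat \<Rightarrow> nat" where
  "ball_vol \<iota> N \<rho> = card (rank_ball \<iota> (0 :: 'a ^ 'n) \<rho>)"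

definition ball_inter_vol ::
    "('k::field \<Rightarrow> 'a::field) \<Rightarrow> 'n::finite itself \<Rightarrow> nat \<Rightarrow> nat \<Rightarrow> nat" where
  "ball_inter_vol \<iota> N \<rho> d =
     (THE k. \<forall>x y :: 'a ^ 'n. rank_dist \<iota> x y = d \<longrightarrow>
        card (rank_ball \<iota> x \<rho> \<inter> rank_ball \<iota> y \<rho>) = k)"

definition rank_covering_radius ::
    "('k::field \<Rightarrow> 'a::field) \<Rightarrow> ('a ^ 'n::finite) set \<Rightarrow> nat" where
  "rank_covering_radius \<iota> C = (MAX x. MIN c\<in>C. rank_dist \<iota> x c)"

definition rank_covering_number ::
    "('k::field \<Rightarrow> 'a::field) \<Rightarrow> 'n::finite itself \<Rightarrow> nat \<Rightarrow> nat" where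
  "rank_covering_number \<iota> N \<rho> =
     Min {card C | C :: ('a ^ 'n) set. C \<noteq> {} \<and> rank_covering_radius \<iota> C \<le> \<rho>}"

end

theory Submission
  imports Defs
begin

text \<open>
  By the pigeonhole principle, more than \<open>q\<^sup>a\<^sup>m\<close> codewords contain two that agree on \<open>a\<close>
  coordinates and hence lie at rank distance at most \<open>n - a\<close>. Since \<open>I(\<rho>, d)\<close> decreases
  in \<open>d\<close>, removing one of the two removes at most \<open>v(\<rho>) - I(\<rho>, n - a)\<close> points from the
  union of the balls. Dismantling a minimum covering code in this way bounds \<open>q\<^sup>m\<^sup>n\<close> from
  above.
\<close>

section \<open>Finite combinatorics: bijections, pigeonhole, overlapping unions\<close>

text \<open>The complements have equal size, so a bijection between them can be glued to
  \<open>f\<close>. This serves both for permutations of coordinates and for matching bases.\<close>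

lemma bij_betw_extend:
  assumes "bij_betw f A B" "A \<subseteq> A'" "B \<subseteq> B'" "finite A'" "finite B'" "card A' = card B'"
  shows "\<exists>g. bij_betw g A' B' \<and> (\<forall>a\<in>A. g a = f a)"
proof -
  have "card A = card B" using assms(1) by (rule bij_betw_same_card)
  moreover have "finite A" "finite B" using assms finite_subset by auto
  ultimately have "card (A' - A) = card (B' - B)"
    using assms by (simp add: card_Diff_subset)
  then obtain h where h: "bij_betw h (A' - A) (B' - B)"
    using assms by (metis finite_Diff finite_same_card_bij)
  define g where "g = (\<lambda>x. if x \<in> A then f x else h x)"
  have "bij_betw g A B" using assms(1) by (rule bij_betw_cong[THEN iffD1, rotated]) (simp add: g_def)
  moreover have "bij_betw g (A' - A) (B' - B)"
    using h by (rule bij_betw_cong[THEN iffD1, rotated]) (simp add: g_def)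
  ultimately have "bij_betw g (A \<union> (A' - A)) (B \<union> (B' - B))"
    by (rule bij_betw_combine) auto
  moreover have "A \<union> (A' - A) = A'" "B \<union> (B' - B) = B'" using assms by auto
  ultimately show ?thesis by (intro exI[of _ g]) (simp add: g_def)
qed

lemma exists_pair_agreeing_on:
  fixes S :: "('a::finite ^ 'n::finite) set"
  assumes "CARD('a) ^ a < card S" "a \<le> CARD('n)"
  obtains x y D where "x \<in> S" "y \<in> S" "x \<noteq> y" "card D = a" "\<And>i. i \<in> D \<Longrightarrow> x $ i = y $ i"
proof -
  obtain D :: "'n set" where D: "card D = a"
    using assms(2) by (metis obtain_subset_with_card_n)
  define p where "p = (\<lambda>x :: 'a ^ 'n. restrict (\<lambda>i. x $ i) D)"
  have sub: "p ` S \<subseteq> (\<Pi>\<^sub>E i\<in>D. UNIV)" by (auto simp: p_def)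
  have fin: "finite (\<Pi>\<^sub>E i\<in>D. (UNIV :: 'a set))" by (intro finite_PiE) auto
  have "card (p ` S) \<le> card (\<Pi>\<^sub>E i\<in>D. (UNIV :: 'a set))" by (rule card_mono[OF fin sub])
  also have "\<dots> = CARD('a) ^ a" by (simp add: card_PiE D)
  finally have "\<not> inj_on p S" using assms(1) by (metis card_image leD)
  then obtain x y where "x \<in> S" "y \<in> S" "x \<noteq> y" "p x = p y" by (auto simp: inj_on_def)
  moreover have "x $ i = y $ i" if "i \<in> D" for i
    using fun_cong[OF \<open>p x = p y\<close>, of i] that by (simp add: p_def)
  ultimately show thesis using D that by blast
qed

text \<open>When \<open>B x\<close> is removed, its partner \<open>B y\<close> stays in the union,
  so the union shrinks by at most \<open>v - g\<close>; \<open>L\<close> is the overlap already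
  gained at size \<open>s\<close>. The additive form avoids truncated subtraction.\<close>

lemma card_UN_pair_overlap_le:
  fixes B :: "'b::finite \<Rightarrow> 'c::finite set"
  assumes base: "\<And>S. card S = s \<Longrightarrow> card (\<Union>c\<in>S. B c) + L \<le> s * v"
    and v: "\<And>c. card (B c) = v"
    and pair: "\<And>S. s < card S \<Longrightarrow>
        \<exists>x\<in>S. \<exists>y\<in>S. x \<noteq> y \<and> g \<le> card (B x \<inter> B y)"
    and "card S = s + t"
  shows "card (\<Union>c\<in>S. B c) + (L + t * g) \<le> (s + t) * v"
  using \<open>card S = s + t\<close>
proof (induction t arbitrary: S)
  case 0
  then show ?case using base by simp
next
  case (Suc t)
  then obtain x y where xy: "x \<in> S" "y \<in> S" "x \<noteq> y" "g \<le> card (B x \<inter> B y)"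
    using pair[of S] by auto
  let ?U = "\<Union>c\<in>S - {x}. B c"
  have "card (S - {x}) = s + t" using Suc.prems xy by simp
  then have IH: "card ?U + (L + t * g) \<le> (s + t) * v" by (rule Suc.IH)
  have "card (?U \<union> B x) + card (?U \<inter> B x) = card ?U + v"
    using card_Un_Int[of ?U "B x"] v by simp
  moreover have "card (B x \<inter> B y) \<le> card (?U \<inter> B x)"
    using xy by (intro card_mono) auto
  moreover have "?U \<union> B x = (\<Union>c\<in>S. B c)" using xy by auto
  ultimately show ?case using IH xy(4) by simp
qed

section \<open>Rank as the dimension of the span of the coordinates\<close>

locale rank_metric =
  fixes \<iota> :: "'k::{field, finite} \<Rightarrow> 'a::{field, finite}"
  assumes embedding: "field_embedding \<iota>"
begin

sublocale V: vector_space "scale_by \<iota>"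
  by (rule vector_space_scale_by[OF embedding])

text \<open>Any basis will do; extending the empty set gives one, finite because the type
  is.\<close>

sublocale V: finite_dimensional_vector_space "scale_by \<iota>" "V.extend_basis {}"
  by unfold_locales (auto simp: V.span_extend_basis V.independent_extend_basis V.independent_empty)

sublocale VV: finite_dimensional_vector_space_pair
  "scale_by \<iota>" "V.extend_basis {}" "scale_by \<iota>" "V.extend_basis {}"
  by unfold_locales

abbreviation linear_map :: "('a \<Rightarrow> 'a) \<Rightarrow> bool" where
  "linear_map \<equiv> Vector_Spaces.linear (scale_by \<iota>) (scale_by \<iota>)"

text \<open>A basis of the span can be chosen among the coordinates themselves. Ranks can then be
  compared by comparing spans.\<close>

lemma rk_eq_dim: "rk \<iota> x = V.dim (range (($) x))"
  unfolding rk_def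
proof (rule Max_eqI)
  show "finite {card B |B. B \<subseteq> range (\<lambda>i. x $ i) \<and> V.independent B}"
    by (rule finite_subset[of _ "card ` UNIV"]) auto
  show "y \<le> V.dim (range (($) x))"
    if "y \<in> {card B |B. B \<subseteq> range (\<lambda>i. x $ i) \<and> V.independent B}" for y
    using that V.independent_card_le_dim by auto
  obtain B where "B \<subseteq> range (($) x)" "V.independent B" "card B = V.dim (range (($) x))"
    using V.basis_exists by metis
  then show "V.dim (range (($) x)) \<in> {card B |B. B \<subseteq> range (\<lambda>i. x $ i) \<and> V.independent B}"
    by (metis (mono_tags, lifting) mem_Collect_eq)
qed

lemma rk_le_card_support:
  fixes x :: "'a ^ 'n"
  assumes "\<And>i. i \<notin> J \<Longrightarrow> x $ i = 0"
  shows "rk \<iota> x \<le> card J"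
proof -
  have "range (($) x) \<subseteq> V.span (($) x ` J)"
  proof safe
    fix i
    show "x $ i \<in> V.span (($) x ` J)"
      using assms[of i] V.span_zero by (cases "i \<in> J") (auto intro: V.span_base)
  qed
  then have "rk \<iota> x \<le> card (($) x ` J)"
    unfolding rk_eq_dim by (rule V.dim_le_card) simp
  also have "\<dots> \<le> card J" by (rule card_image_le) simp
  finally show ?thesis .
qed

lemma rk_eq_card_support:
  fixes x :: "'a ^ 'n"
  assumes "\<And>i. i \<notin> J \<Longrightarrow> x $ i = 0" "inj_on (($) x) J" "V.independent (($) x ` J)"
  shows "rk \<iota> x = card J"
proof (rule antisym)
  show "rk \<iota> x \<le> card J" using assms(1) by (rule rk_le_card_support)
  have "card (($) x ` J) \<le> rk \<iota> x"
    unfolding rk_eq_dim using assms(3) by (intro V.independent_card_le_dim) auto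
  then show "card J \<le> rk \<iota> x" using assms(2) by (simp add: card_image)
qed

lemma rk_minus_commute: "rk \<iota> (x - y) = rk \<iota> (y - x)"
proof -
  have "V.span (range (($) (x - y))) = V.span (range (($) (y - x)))"
  proof (rule V.span_eq[THEN iffD2], safe)
    fix i
    have "(x - y) $ i = - ((y - x) $ i)" "(y - x) $ i = - ((x - y) $ i)" by auto
    then show "(x - y) $ i \<in> V.span (range (($) (y - x)))"
      "(y - x) $ i \<in> V.span (range (($) (x - y)))"
      by (metis V.span_neg V.span_base rangeI)+
  qed
  then show ?thesis unfolding rk_eq_dim by (rule V.span_eq_dim)
qed

section \<open>Intersections of two balls and isometries of the rank metric\<close>

text \<open>By translation invariance one centre is moved to \<open>0\<close>. The argument is a
  vector rather than a distance, since dependence on the rank alone is proved only later.\<close>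

definition ball_inter :: "nat \<Rightarrow> 'a ^ 'n \<Rightarrow> nat" where
  "ball_inter \<rho> z = card {x. rk \<iota> x \<le> \<rho> \<and> rk \<iota> (x - z) \<le> \<rho>}"

lemma card_rank_ball_inter:
  "card (rank_ball \<iota> x \<rho> \<inter> rank_ball \<iota> y \<rho>) = ball_inter \<rho> (y - x)"
  unfolding ball_inter_def
proof (rule bij_betw_same_card)
  show "bij_betw (\<lambda>w. w - x) (rank_ball \<iota> x \<rho> \<inter> rank_ball \<iota> y \<rho>)
     {w. rk \<iota> w \<le> \<rho> \<and> rk \<iota> (w - (y - x)) \<le> \<rho>}"
    by (rule bij_betwI[where g = "\<lambda>w. w + x"])
      (auto simp: rank_ball_def rank_dist_def algebra_simps)
qed

lemma card_rank_ball:
  fixes x :: "'a ^ 'n"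
  shows "card (rank_ball \<iota> x \<rho>) = ball_vol \<iota> TYPE('n) \<rho>"
proof -
  \<comment> \<open>A ball is its own intersection with itself, and both differences of centres
    vanish.\<close>
  have "ball_inter \<rho> (x - x) = ball_inter \<rho> (0 - 0 :: 'a ^ 'n)" by simp
  then show ?thesis unfolding ball_vol_def card_rank_ball_inter[symmetric] by simp
qed

text \<open>Compatibility with differences turns the distance to \<open>z\<close> into the distance
  to \<open>T z\<close>; rank invariance preserves the ball at \<open>0\<close>.\<close>

definition rank_isometry :: "('a ^ 'n \<Rightarrow> 'a ^ 'n) \<Rightarrow> bool" where
  "rank_isometry T \<longleftrightarrow>
     bij T \<and> (\<forall>x y. T (x - y) = T x - T y) \<and> (\<forall>x. rk \<iota> (T x) = rk \<iota> x)"

lemma ball_inter_isometry: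
  assumes "rank_isometry T"
  shows "ball_inter \<rho> (T z) = ball_inter \<rho> z"
proof -
  have T: "bij T" "T (x - y) = T x - T y" "rk \<iota> (T x) = rk \<iota> x" for x y
    using assms by (auto simp: rank_isometry_def)
  have "bij_betw T {x. rk \<iota> x \<le> \<rho> \<and> rk \<iota> (x - z) \<le> \<rho>}
     {x. rk \<iota> x \<le> \<rho> \<and> rk \<iota> (x - T z) \<le> \<rho>}"
  proof (rule bij_betw_imageI)
    show "inj_on T {x. rk \<iota> x \<le> \<rho> \<and> rk \<iota> (x - z) \<le> \<rho>}"
      using T(1) by (meson bij_is_inj inj_on_subset subset_UNIV)
    show "T ` {x. rk \<iota> x \<le> \<rho> \<and> rk \<iota> (x - z) \<le> \<rho>}
       = {x. rk \<iota> x \<le> \<rho> \<and> rk \<iota> (x - T z) \<le> \<rho>}"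
    proof (intro equalityI subsetI)
      fix y assume y: "y \<in> {x. rk \<iota> x \<le> \<rho> \<and> rk \<iota> (x - T z) \<le> \<rho>}"
      obtain x where "y = T x" using T(1) by (metis bij_pointE)
      with y show "y \<in> T ` {x. rk \<iota> x \<le> \<rho> \<and> rk \<iota> (x - z) \<le> \<rho>}"
        using T(3)[of "x - z"] by (auto simp: T)
    next
      fix y assume "y \<in> T ` {x. rk \<iota> x \<le> \<rho> \<and> rk \<iota> (x - z) \<le> \<rho>}"
      then obtain x where x: "y = T x" "rk \<iota> x \<le> \<rho>" "rk \<iota> (x - z) \<le> \<rho>" by auto
      then show "y \<in> {x. rk \<iota> x \<le> \<rho> \<and> rk \<iota> (x - T z) \<le> \<rho>}"
        using T(3)[of "x - z"] T(3)[of x] by (simp add: T(2))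
    qed
  qed
  then show ?thesis unfolding ball_inter_def by (rule bij_betw_same_card[symmetric])
qed

text \<open>Both sets extend to bases of equal size and \<open>f\<close> to a bijection of these
  bases. Its linear extension is onto, hence bijective on a finite field.\<close>

lemma linear_bij_extend:
  assumes "V.independent B" "V.independent C" "bij_betw f B C"
  obtains g where "linear_map g" "bij g" "\<And>b. b \<in> B \<Longrightarrow> g b = f b"
proof -
  let ?E = "V.extend_basis B" and ?F = "V.extend_basis C"
  have card: "card ?E = card ?F"
    using V.dim_eq_card[of ?E UNIV] V.dim_eq_card[of ?F UNIV] assms
    by (simp add: V.span_extend_basis V.independent_extend_basis)
  have "B \<subseteq> ?E" "C \<subseteq> ?F" using assms by (simp_all add: V.extend_basis_superset)
  with bij_betw_extend[OF assms(3) this _ _ card] obtain h where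
    h: "bij_betw h ?E ?F" "\<And>b. b \<in> B \<Longrightarrow> h b = f b" by auto
  obtain g where g: "linear_map g" "\<And>b. b \<in> ?E \<Longrightarrow> g b = h b"
    using VV.linear_independent_extend[OF V.independent_extend_basis[OF assms(1)]] by metis
  have "g ` UNIV = g ` V.span ?E" using assms by (simp add: V.span_extend_basis)
  also have "\<dots> = V.span (g ` ?E)" using g(1) by (metis VV.linear_span_image)
  also have "g ` ?E = ?F" using g(2) h(1) by (metis bij_betw_imp_surj_on image_cong)
  finally have "surj g" using assms by (simp add: V.span_extend_basis)
  then have "bij g" by (simp add: bij_def finite_UNIV_surj_inj)
  moreover have "g b = f b" if "b \<in> B" for b
    using g h that V.extend_basis_superset[OF assms(1)] by auto
  ultimately show thesis using g(1) that by blast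
qed

lemma rank_isometry_coordinatewise:
  fixes \<sigma> :: "'n::finite \<Rightarrow> 'n"
  assumes "linear_map g" "bij g" "bij \<sigma>"
  shows "rank_isometry (\<lambda>x. \<chi> i. g (x $ \<sigma> i))"
  unfolding rank_isometry_def
proof (intro conjI allI)
  have "inj (\<lambda>x. \<chi> i. g (x $ \<sigma> i))"
  proof (rule injI)
    fix x y :: "'a ^ 'n"
    assume eq: "(\<chi> i. g (x $ \<sigma> i)) = (\<chi> i. g (y $ \<sigma> i))"
    have "x $ i = y $ i" for i
    proof -
      obtain j where "i = \<sigma> j" using assms(3) by (metis bij_pointE)
      moreover have "g (x $ \<sigma> j) = g (y $ \<sigma> j)" using eq by (simp add: vec_eq_iff)
      ultimately show ?thesis using assms(2) by (simp add: bij_def inj_eq)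
    qed
    then show "x = y" by (simp add: vec_eq_iff)
  qed
  then show "bij (\<lambda>x. \<chi> i. g (x $ \<sigma> i))" by (simp add: bij_def finite_UNIV_inj_surj)
  fix x y :: "'a ^ 'n"
  show "(\<chi> i. g ((x - y) $ \<sigma> i)) = (\<chi> i. g (x $ \<sigma> i)) - (\<chi> i. g (y $ \<sigma> i))"
    using VV.linear_diff[OF assms(1)] by (simp add: vec_eq_iff)
  have "range (($) (\<chi> i. g (x $ \<sigma> i))) = g ` (($) x) ` range \<sigma>" by (auto simp: image_image)
  also have "range \<sigma> = UNIV" using assms(3) by (rule bij_is_surj)
  finally show "rk \<iota> (\<chi> i. g (x $ \<sigma> i)) = rk \<iota> x"
    unfolding rk_eq_dim using assms(1,2)
    by (metis VV.dim_image_eq bij_is_inj inj_on_subset subset_UNIV)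
qed

text \<open>These are column operations over \<open>GF(q)\<close>: invertible, and without effect on
  the span of the entries.\<close>

lemma rank_isometry_column_reduction:
  fixes c :: "'n::finite \<Rightarrow> 'n \<Rightarrow> 'k"
  shows "rank_isometry
    (\<lambda>x. \<chi> i. if i \<in> J then x $ i else x $ i - (\<Sum>j\<in>J. \<iota> (c i j) * x $ j))"
  (is "rank_isometry ?T")
proof -
  define T where "T = ?T"
  \<comment> \<open>\<open>R\<close> undoes \<open>T\<close>: entries indexed by \<open>J\<close>
    are left alone, so the subtracted sum can be rebuilt from \<open>T x\<close>. This yields
    injectivity and one of the two span inclusions.\<close>
  define R where "R = (\<lambda>(x :: 'a ^ 'n) i. x $ i + (if i \<in> J then 0 else \<Sum>j\<in>J. \<iota> (c i j) * x $ j))"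
  have R: "R (T x) i = x $ i" for x i by (simp add: R_def T_def)
  have "rank_isometry T"
    unfolding rank_isometry_def
  proof (intro conjI allI)
    have "inj T" by (rule injI) (metis R vec_eq_iff)
    then show "bij T" by (simp add: bij_def finite_UNIV_inj_surj)
    fix x y
    show "T (x - y) = T x - T y"
      by (simp add: T_def vec_eq_iff algebra_simps sum_subtractf)
    have "V.span (range (($) (T x))) = V.span (range (($) x))"
    proof (rule V.span_eq[THEN iffD2], safe)
      fix i
      show "T x $ i \<in> V.span (range (($) x))"
        by (auto simp: T_def intro!: V.span_diff V.span_sum V.span_scale intro: V.span_base)
      have "R (T x) i \<in> V.span (range (($) (T x)))"
        by (auto simp: R_def intro!: V.span_add V.span_sum V.span_scale intro: V.span_base)
      then show "x $ i \<in> V.span (range (($) (T x)))" by (simp only: R)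
    qed
    then show "rk \<iota> (T x) = rk \<iota> x" unfolding rk_eq_dim by (rule V.span_eq_dim)
  qed
  then show ?thesis by (simp only: T_def)
qed

text \<open>The entries indexed by \<open>J\<close> are a basis of the span of all entries, so
  column operations clear every other entry.\<close>

lemma rank_normal_form:
  fixes z :: "'a ^ 'n"
  obtains J T where "rank_isometry T" "T z = (\<chi> i. if i \<in> J then z $ i else 0)"
    "inj_on (($) z) J" "V.independent (($) z ` J)" "card J = rk \<iota> z"
proof -
  obtain B where B: "B \<subseteq> range (($) z)" "V.independent B" "range (($) z) \<subseteq> V.span B"
      "card B = V.dim (range (($) z))"
    using V.basis_exists by metis
  obtain J where J: "inj_on (($) z) J" "B = ($) z ` J"
    using B(1) by (metis subset_image_inj)
  have "\<exists>c. z $ i = (\<Sum>j\<in>J. \<iota> (c j) * z $ j)" for i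
  proof -
    have "z $ i \<in> V.span B" using B(3) by auto
    then obtain u where "z $ i = (\<Sum>b\<in>B. \<iota> (u b) * b)"
      using V.span_finite[of B] by auto
    also have "\<dots> = (\<Sum>j\<in>J. \<iota> (u (z $ j)) * z $ j)"
      unfolding J(2) by (simp add: sum.reindex[OF J(1)])
    finally show ?thesis by (rule exI[of _ "\<lambda>j. u (z $ j)"])
  qed
  then obtain c where c: "\<And>i. z $ i = (\<Sum>j\<in>J. \<iota> (c i j) * z $ j)" by metis
  show thesis
  proof (rule that[OF rank_isometry_column_reduction[of J c]])
    show "(\<chi> i. if i \<in> J then z $ i else z $ i - (\<Sum>j\<in>J. \<iota> (c i j) * z $ j))
       = (\<chi> i. if i \<in> J then z $ i else 0)"
      by (simp add: vec_eq_iff flip: c)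
    show "inj_on (($) z) J" "V.independent (($) z ` J)" using J B by auto
    show "card J = rk \<iota> z" using J B by (simp add: rk_eq_dim card_image)
  qed
qed

text \<open>Isometries act transitively on vectors of equal rank: once dependent entries are
  cleared, a permutation aligns the supports and a linear bijection matches the independent
  entries.\<close>

lemma ball_inter_cong_rk:
  fixes z z' :: "'a ^ 'n"
  assumes "rk \<iota> z = rk \<iota> z'"
  shows "ball_inter \<rho> z = ball_inter \<rho> z'"
proof -
  obtain J T where T: "rank_isometry T" "T z = (\<chi> i. if i \<in> J then z $ i else 0)"
    and J: "inj_on (($) z) J" "V.independent (($) z ` J)" "card J = rk \<iota> z"
    using rank_normal_form[of z] by blast
  obtain J' T' where T': "rank_isometry T'" "T' z' = (\<chi> i. if i \<in> J' then z' $ i else 0)"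
    and J': "inj_on (($) z') J'" "V.independent (($) z' ` J')" "card J' = rk \<iota> z'"
    using rank_normal_form[of z'] by blast
  obtain s where s: "bij_betw s J' J"
    using J(3) J'(3) assms by (metis finite finite_same_card_bij)
  obtain \<sigma> where \<sigma>: "bij \<sigma>" "\<And>i. i \<in> J' \<Longrightarrow> \<sigma> i = s i"
    using bij_betw_extend[OF s, of UNIV UNIV] by auto
  have \<sigma>J: "\<sigma> i \<in> J \<longleftrightarrow> i \<in> J'" for i
    using s \<sigma> by (metis bij_betw_def bij_is_inj image_iff inj_eq)
  \<comment> \<open>For \<open>i\<close> in \<open>J'\<close> this sends \<open>z $ s i\<close> to
    \<open>z' $ i\<close>.\<close>
  let ?f = "(($) z') \<circ> inv_into J' s \<circ> inv_into J (($) z)"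
  have "bij_betw ?f (($) z ` J) (($) z' ` J')"
    using bij_betw_inv_into[OF inj_on_imp_bij_betw[OF J(1)]] bij_betw_inv_into[OF s]
      inj_on_imp_bij_betw[OF J'(1)]
    by (blast intro: bij_betw_trans)
  then obtain g where g: "linear_map g" "bij g" "\<And>b. b \<in> ($) z ` J \<Longrightarrow> g b = ?f b"
    using linear_bij_extend[OF J(2) J'(2)] by metis
  have "g (T z $ \<sigma> i) = T' z' $ i" for i
  proof (cases "i \<in> J'")
    case True
    then have "s i \<in> J" using s by (auto simp: bij_betw_def)
    then have "g (z $ s i) = z' $ i"
      using g(3) J(1) s True by (simp add: bij_betw_def)
    then show ?thesis using True \<sigma> \<open>s i \<in> J\<close> by (simp add: T(2) T'(2))
  next
    case False
    then show ?thesis using \<sigma>J VV.linear_0[OF g(1)] by (simp add: T(2) T'(2))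
  qed
  then have "T' z' = (\<chi> i. g (T z $ \<sigma> i))" by (simp add: vec_eq_iff)
  then show ?thesis
    using ball_inter_isometry[OF rank_isometry_coordinatewise[OF g(1,2) \<sigma>(1)]]
      ball_inter_isometry[OF T(1)] ball_inter_isometry[OF T'(1)] by metis
qed

text \<open>The pair \<open>0\<close>, \<open>z\<close> realises the distance
  \<open>rk \<iota> z\<close>, which makes the definite description unique.\<close>

lemma ball_inter_vol_eq:
  fixes z :: "'a ^ 'n"
  shows "ball_inter_vol \<iota> TYPE('n) \<rho> (rk \<iota> z) = ball_inter \<rho> z"
  unfolding ball_inter_vol_def card_rank_ball_inter rank_dist_def
proof (rule the_equality)
  show "\<forall>x y :: 'a ^ 'n. rk \<iota> (x - y) = rk \<iota> z \<longrightarrow> ball_inter \<rho> (y - x) = ball_inter \<rho> z"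
    using ball_inter_cong_rk rk_minus_commute by metis
  fix k
  assume *: "\<forall>x y :: 'a ^ 'n. rk \<iota> (x - y) = rk \<iota> z \<longrightarrow> ball_inter \<rho> (y - x) = k"
  have "rk \<iota> (0 - z) = rk \<iota> z" using rk_minus_commute[of 0 z] by simp
  then show "k = ball_inter \<rho> z" using *[rule_format, of 0 z] by simp
qed

section \<open>Fibres of balls along one coordinate\<close>

definition fibre :: "'n::finite \<Rightarrow> nat \<Rightarrow> 'a ^ 'n \<Rightarrow> 'a set" where
  "fibre j \<rho> x = {y. rk \<iota> (\<chi> i. if i = j then y else x $ i) \<le> \<rho>}"

text \<open>Let \<open>d\<close> be the dimension spanned by the other entries. A value in their
  span gives rank \<open>d\<close>, any other value \<open>d + 1\<close>. So the fibre is empty, the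
  span or everything as \<open>\<rho>\<close> is below, equal to or above \<open>d\<close>.\<close>

lemma fibre_cases:
  fixes x :: "'a ^ 'n"
  shows "fibre j \<rho> x \<in> {{}, UNIV, V.span (($) x ` (- {j}))}"
proof -
  let ?A = "($) x ` (- {j})"
  have rk: "rk \<iota> (\<chi> i. if i = j then y else x $ i)
      = (if y \<in> V.span ?A then V.dim ?A else V.dim ?A + 1)" for y
  proof -
    have "range (($) (\<chi> i. if i = j then y else x $ i)) = insert y ?A"
    proof (intro equalityI subsetI)
      fix w assume "w \<in> insert y ?A"
      then consider "w = y" | i where "i \<noteq> j" "w = x $ i" by auto
      then show "w \<in> range (($) (\<chi> i. if i = j then y else x $ i))"
        by cases (auto intro: range_eqI[of _ _ j] range_eqI)
    qed auto
    then show ?thesis unfolding rk_eq_dim by (simp add: V.dim_insert)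
  qed
  consider "\<rho> < V.dim ?A" | "\<rho> = V.dim ?A" | "V.dim ?A < \<rho>" by linarith
  then show ?thesis by cases (auto simp: fibre_def rk)
qed

text \<open>If the coset meets \<open>W\<close> in a point \<open>p\<close>, subtracting
  \<open>p\<close> injects the intersection into \<open>W \<inter> W'\<close>.\<close>

lemma card_Int_coset_le:
  assumes "V.subspace W" "V.subspace W'"
  shows "card (W \<inter> (\<lambda>y. y + w) ` W') \<le> card (W \<inter> W')"
proof (cases "W \<inter> (\<lambda>y. y + w) ` W' = {}")
  case False
  then obtain y where "y + w \<in> W" "y \<in> W'" by auto
  then obtain p where p: "p \<in> W" "p - w \<in> W'" using add_diff_cancel by metis
  show ?thesis
  proof (rule card_inj_on_le)
    show "inj_on (\<lambda>y. y - p) (W \<inter> (\<lambda>y. y + w) ` W')" by (auto simp: inj_on_def)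
    show "(\<lambda>y. y - p) ` (W \<inter> (\<lambda>y. y + w) ` W') \<subseteq> W \<inter> W'"
    proof safe
      fix y assume y: "y + w \<in> W" "y \<in> W'"
      show "y + w - p \<in> W" using V.subspace_diff[OF assms(1) y(1) p(1)] .
      show "y + w - p \<in> W'"
        using V.subspace_diff[OF assms(2) y(2) p(2)] by (simp add: algebra_simps)
    qed
  qed simp
qed simp

lemma card_fibre_Int_translate_le:
  "card (fibre j \<rho> x \<inter> (\<lambda>y. y + w) ` fibre j \<rho> x') \<le> card (fibre j \<rho> x \<inter> fibre j \<rho> x')"
proof -
  have "inj (\<lambda>y. y + w)" "surj (\<lambda>y. y + w)"
    by (auto simp: inj_on_def intro: surjI[of _ "\<lambda>y. y - w"])
  then have [simp]: "card ((\<lambda>y. y + w) ` S) = card S" "range (\<lambda>y. y + w) = UNIV" for S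
    by (auto simp: card_image inj_on_subset)
  show ?thesis
    using fibre_cases[of j \<rho> x] fibre_cases[of j \<rho> x']
      card_Int_coset_le[OF V.subspace_span V.subspace_span]
    by auto
qed

text \<open>
  Fix all coordinates of \<open>x\<close> but the \<open>j\<close>-th. The admissible values of \<open>x $ j\<close> for each of
  the two balls form nothing, everything or a subspace, and changing \<open>z $ j\<close> from \<open>0\<close> to \<open>w\<close>
  translates the second set. Translating one of two subspaces never enlarges their
  intersection.
\<close>

lemma ball_inter_axis_le:
  fixes z :: "'a ^ 'n"
  assumes "z $ j = 0"
  shows "ball_inter \<rho> (z + axis j w) \<le> ball_inter \<rho> z"
proof -
  \<comment> \<open>The entry \<open>0\<close> at \<open>j\<close> is a placeholder:
    \<open>?F\<close> represents the choices of the other coordinates, and \<open>?u\<close> fills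
    in the missing one.\<close>
  let ?F = "{x :: 'a ^ 'n. x $ j = 0}"
  let ?u = "\<lambda>(x :: 'a ^ 'n, y). (\<chi> i. if i = j then y else x $ i)"
  have count: "ball_inter \<rho> (z + axis j w)
     = (\<Sum>x\<in>?F. card (fibre j \<rho> x \<inter> (\<lambda>y. y + w) ` fibre j \<rho> (x - z)))" for w
  proof -
    let ?S = "\<lambda>x. fibre j \<rho> x \<inter> (\<lambda>y. y + w) ` fibre j \<rho> (x - z)"
    have S: "y \<in> ?S x \<longleftrightarrow> rk \<iota> (?u (x, y)) \<le> \<rho> \<and> rk \<iota> (?u (x, y) - (z + axis j w)) \<le> \<rho>" for x y
    proof -
      have "y \<in> (\<lambda>y. y + w) ` fibre j \<rho> (x - z) \<longleftrightarrow> y - w \<in> fibre j \<rho> (x - z)"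
        by (auto simp: image_iff) (metis diff_add_cancel)
      moreover have "(\<chi> i. if i = j then y - w else (x - z) $ i) = ?u (x, y) - (z + axis j w)"
        using assms by (simp add: vec_eq_iff axis_def)
      ultimately show ?thesis by (simp add: fibre_def)
    qed
    have "bij_betw ?u (Sigma ?F ?S)
      {x. rk \<iota> x \<le> \<rho> \<and> rk \<iota> (x - (z + axis j w)) \<le> \<rho>}"
    proof (rule bij_betwI[where g = "\<lambda>x. (\<chi> i. if i = j then 0 else x $ i, x $ j)"])
      show "?u \<in> Sigma ?F ?S \<rightarrow> {x. rk \<iota> x \<le> \<rho> \<and> rk \<iota> (x - (z + axis j w)) \<le> \<rho>}"
        using S by blast
      have "?u (\<chi> i. if i = j then 0 else x $ i, x $ j) = x" for x
        by (simp add: vec_eq_iff)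
      then show "(\<lambda>x. (\<chi> i. if i = j then 0 else x $ i, x $ j))
          \<in> {x. rk \<iota> x \<le> \<rho> \<and> rk \<iota> (x - (z + axis j w)) \<le> \<rho>} \<rightarrow> Sigma ?F ?S"
        "?u (\<chi> i. if i = j then 0 else x $ i, x $ j) = x" for x
        using S by auto
    qed (auto simp: vec_eq_iff)
    then have "ball_inter \<rho> (z + axis j w) = card (Sigma ?F ?S)"
      unfolding ball_inter_def by (metis (no_types, lifting) bij_betw_same_card)
    then show ?thesis by simp
  qed
  \<comment> \<open>\<open>count\<close> is applied to \<open>w\<close> and to \<open>0\<close>; the
    shift by \<open>0\<close> fixes the fibre, so the sums compare term by term.\<close>
  have "ball_inter \<rho> (z + axis j w) \<le> ball_inter \<rho> (z + axis j 0)"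
    unfolding count using card_fibre_Int_translate_le by (intro sum_mono) simp
  moreover have "axis j 0 = (0 :: 'a ^ 'n)" by (simp add: vec_eq_iff axis_def)
  ultimately show ?thesis by simp
qed

section \<open>Vectors of prescribed rank and antitonicity in the distance\<close>

text \<open>Every element is determined by its coefficients in a basis. Hence a field of
  \<open>q ^ m\<close> elements has dimension at least \<open>m\<close>, which leaves room for
  \<open>n \<le> m\<close> independent entries.\<close>

lemma card_le_card_power_dim: "CARD('a) \<le> CARD('k) ^ V.dim UNIV"
proof -
  obtain B where B: "V.independent B" "UNIV \<subseteq> V.span B" "card B = V.dim UNIV"
    using V.basis_exists[of UNIV] by metis
  let ?f = "\<lambda>u. \<Sum>b\<in>B. \<iota> (u b) * b"
  have "UNIV \<subseteq> ?f ` (\<Pi>\<^sub>E b\<in>B. UNIV)"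
  proof
    fix x
    have "x \<in> V.span B" using B(2) by auto
    then obtain u where "x = ?f u" using V.span_finite[of B] by auto
    then have "x = ?f (restrict u B)" by simp
    then show "x \<in> ?f ` (\<Pi>\<^sub>E b\<in>B. UNIV)"
      by (rule image_eqI[of x ?f "restrict u B"]) auto
  qed
  then have "CARD('a) \<le> card (\<Pi>\<^sub>E b\<in>B. UNIV :: 'k set)"
    by (rule surj_card_le[rotated]) (intro finite_PiE, auto)
  then show ?thesis by (simp add: card_PiE B(3))
qed

lemma exists_independent_family:
  fixes J :: "'n::finite set"
  assumes "card J \<le> V.dim UNIV"
  obtains f where "inj_on f J" "V.independent (f ` J)"
proof -
  obtain B where B: "V.independent B" "card B = V.dim UNIV"
    using V.basis_exists[of UNIV] by metis
  then obtain f where "inj_on f J" "f ` J \<subseteq> B"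
    using assms card_le_inj[of J B] by auto
  then show thesis using B V.independent_mono that by blast
qed

lemma exists_rk_eq:
  assumes "d \<le> CARD('n)" "CARD('n) \<le> V.dim UNIV"
  shows "\<exists>z :: 'a ^ 'n. rk \<iota> z = d"
proof -
  obtain J :: "'n set" where J: "card J = d"
    using assms(1) by (metis obtain_subset_with_card_n)
  then obtain f where f: "inj_on f J" "V.independent (f ` J)"
    using assms exists_independent_family[of J] by (metis order_trans)
  let ?z = "(\<chi> i. if i \<in> J then f i else 0) :: 'a ^ 'n"
  have "($) ?z ` J = f ` J" "inj_on (($) ?z) J" using f(1) by (auto simp: inj_on_def)
  then have "rk \<iota> ?z = card J" using f by (intro rk_eq_card_support) auto
  then show ?thesis using J by blast
qed

text \<open>A vector with \<open>Suc d\<close> independent entries and zeros elsewhere drops to rank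
  \<open>d\<close> when one entry is erased, and erasing an entry does not shrink the
  intersection.\<close>

lemma ball_inter_vol_Suc_le:
  assumes "Suc d \<le> CARD('n::finite)" "CARD('n) \<le> V.dim UNIV"
  shows "ball_inter_vol \<iota> TYPE('n) \<rho> (Suc d) \<le> ball_inter_vol \<iota> TYPE('n) \<rho> d"
proof -
  obtain J :: "'n set" where J: "card J = Suc d"
    using assms(1) by (metis obtain_subset_with_card_n)
  then obtain f where f: "inj_on f J" "V.independent (f ` J)"
    using assms exists_independent_family[of J] by (metis order_trans)
  obtain j where j: "j \<in> J" using J by fastforce
  have rk: "rk \<iota> ((\<chi> i. if i \<in> A then f i else 0) :: 'a ^ 'n) = card A" if "A \<subseteq> J" for A
  proof -
    let ?z = "(\<chi> i. if i \<in> A then f i else 0) :: 'a ^ 'n"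
    have "($) ?z ` A = f ` A" by auto
    moreover have "inj_on (($) ?z) A" using inj_on_subset[OF f(1) that] by (auto simp: inj_on_def)
    moreover have "V.independent (f ` A)"
      by (rule V.independent_mono[OF f(2) image_mono[OF that]])
    ultimately show ?thesis by (intro rk_eq_card_support) auto
  qed
  let ?z = "(\<chi> i. if i \<in> J - {j} then f i else 0) :: 'a ^ 'n"
  have "?z + axis j (f j) = (\<chi> i. if i \<in> J then f i else 0)"
    using j by (auto simp: vec_eq_iff axis_def)
  then have "rk \<iota> (?z + axis j (f j)) = Suc d" using rk[of J] J by simp
  moreover have "rk \<iota> ?z = d" using rk[of "J - {j}"] J j by simp
  ultimately show ?thesis
    using ball_inter_axis_le[of ?z j \<rho> "f j"] by (simp flip: ball_inter_vol_eq)
qed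

lemma ball_inter_vol_antimono:
  assumes "d \<le> d'" "d' \<le> CARD('n::finite)" "CARD('n) \<le> V.dim UNIV"
  shows "ball_inter_vol \<iota> TYPE('n) \<rho> d' \<le> ball_inter_vol \<iota> TYPE('n) \<rho> d"
  using assms(1,2)
proof (induction d' rule: dec_induct)
  case (step e)
  then show ?case using ball_inter_vol_Suc_le[of e, where 'n = 'n] assms(3)
    by (meson Suc_leD order_trans)
qed simp

section \<open>Volume of the union of balls around a code\<close>

lemma exists_pair_overlap:
  fixes S :: "('a ^ 'n) set"
  assumes "CARD('a) ^ a < card S" "a \<le> CARD('n)" "CARD('n) \<le> V.dim UNIV"
  shows "\<exists>x\<in>S. \<exists>y\<in>S. x \<noteq> y \<and> ball_inter_vol \<iota> TYPE('n) \<rho> (CARD('n) - a)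
     \<le> card (rank_ball \<iota> x \<rho> \<inter> rank_ball \<iota> y \<rho>)"
proof -
  obtain x y D where xy: "x \<in> S" "y \<in> S" "x \<noteq> y" and D: "card D = a"
    "\<And>i. i \<in> D \<Longrightarrow> x $ i = y $ i"
    using exists_pair_agreeing_on[OF assms(1,2)] by metis
  have "rk \<iota> (y - x) \<le> card (- D)" using D(2) by (intro rk_le_card_support) auto
  also have "card (- D) = CARD('n) - a" using D(1) by (simp add: Compl_eq_Diff_UNIV card_Diff_subset)
  finally have "ball_inter_vol \<iota> TYPE('n) \<rho> (CARD('n) - a)
      \<le> ball_inter_vol \<iota> TYPE('n) \<rho> (rk \<iota> (y - x))"
    using assms(3) by (intro ball_inter_vol_antimono) auto
  then show ?thesis using xy by (auto simp: ball_inter_vol_eq card_rank_ball_inter)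
qed

text \<open>While more than \<open>CARD('a) ^ (a - 1)\<close> words remain, two agree on
  \<open>a - 1\<close> coordinates, so a removal saves the overlap at distance
  \<open>n - a + 1\<close>. The sum collects these savings level by level; the \<open>t\<close>
  words above the top level save the overlap at distance \<open>n - l\<close>.\<close>

lemma card_UN_rank_ball_le:
  fixes S :: "('a ^ 'n) set"
  assumes "card S = CARD('a) ^ l + t" "l \<le> CARD('n)" "CARD('n) \<le> V.dim UNIV"
  shows "card (\<Union>c\<in>S. rank_ball \<iota> c \<rho>)
    + ((\<Sum>a = 1..l. (CARD('a) ^ a - CARD('a) ^ (a - 1))
         * ball_inter_vol \<iota> TYPE('n) \<rho> (CARD('n) - a + 1))
       + t * ball_inter_vol \<iota> TYPE('n) \<rho> (CARD('n) - l))
    \<le> card S * ball_vol \<iota> TYPE('n) \<rho>"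
  using assms(1,2)
proof (induction l arbitrary: t S)
  let ?I = "ball_inter_vol \<iota> TYPE('n) \<rho>"
  \<comment> \<open>The count starts from one ball, since \<open>CARD('a) ^ 0 = 1\<close>; agreement
    on zero coordinates is automatic.\<close>
  case 0
  have "card (\<Union>c\<in>S. rank_ball \<iota> c \<rho>) + (0 + t * ?I (CARD('n) - 0))
      \<le> (1 + t) * ball_vol \<iota> TYPE('n) \<rho>"
    using 0 assms(3) exists_pair_overlap[of 0, where 'n = 'n]
    by (intro card_UN_pair_overlap_le) (auto simp: card_rank_ball card_1_singleton_iff)
  then show ?case using 0 by simp
next
  let ?I = "ball_inter_vol \<iota> TYPE('n) \<rho>"
  case (Suc l)
  let ?L = "\<Sum>a = 1..l. (CARD('a) ^ a - CARD('a) ^ (a - 1)) * ?I (CARD('n) - a + 1)"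
  \<comment> \<open>The induction hypothesis is used with \<open>?u\<close> in place of
    \<open>t\<close>, so its trailing term becomes the summand for \<open>a = Suc l\<close>.\<close>
  let ?u = "CARD('a) ^ Suc l - CARD('a) ^ l"
  have u: "CARD('a) ^ Suc l = CARD('a) ^ l + ?u" by simp
  have "card (\<Union>c\<in>S. rank_ball \<iota> c \<rho>)
      + ((?L + ?u * ?I (CARD('n) - l)) + t * ?I (CARD('n) - Suc l))
      \<le> (CARD('a) ^ Suc l + t) * ball_vol \<iota> TYPE('n) \<rho>"
  proof (rule card_UN_pair_overlap_le)
    fix R :: "('a ^ 'n) set" assume R: "card R = CARD('a) ^ Suc l"
    have "card R = CARD('a) ^ l + ?u" using R u by argo
    then show "card (\<Union>c\<in>R. rank_ball \<iota> c \<rho>) + (?L + ?u * ?I (CARD('n) - l))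
        \<le> CARD('a) ^ Suc l * ball_vol \<iota> TYPE('n) \<rho>"
      using Suc.IH[of R ?u] Suc.prems R by (metis Suc_leD)
  next
    show "card (rank_ball \<iota> c \<rho>) = ball_vol \<iota> TYPE('n) \<rho>" for c :: "'a ^ 'n"
      by (rule card_rank_ball)
    show "\<exists>x\<in>R. \<exists>y\<in>R. x \<noteq> y \<and> ?I (CARD('n) - Suc l)
        \<le> card (rank_ball \<iota> x \<rho> \<inter> rank_ball \<iota> y \<rho>)"
      if "CARD('a) ^ Suc l < card R" for R :: "('a ^ 'n) set"
      using exists_pair_overlap[OF that Suc.prems(2) assms(3)] .
  qed (rule Suc.prems(1))
  moreover have "CARD('n) - Suc l + 1 = CARD('n) - l" using Suc.prems by simp
  ultimately show ?case using Suc.prems by (simp add: algebra_simps)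
qed

section \<open>Minimum covering codes and the final bound\<close>

lemma rank_covering_number_attained:
  obtains C :: "('a ^ 'n) set" where
    "card C = rank_covering_number \<iota> TYPE('n) \<rho>" "(\<Union>c\<in>C. rank_ball \<iota> c \<rho>) = UNIV"
proof -
  let ?X = "{card C | C :: ('a ^ 'n) set. C \<noteq> {} \<and> rank_covering_radius \<iota> C \<le> \<rho>}"
  have rad: "rank_covering_radius \<iota> C \<le> \<rho> \<longleftrightarrow> (\<Union>c\<in>C. rank_ball \<iota> c \<rho>) = UNIV"
    if "C \<noteq> {}" for C :: "('a ^ 'n) set"
  proof -
    have "rank_covering_radius \<iota> C \<le> \<rho> \<longleftrightarrow> (\<forall>x. \<exists>c\<in>C. rank_dist \<iota> x c \<le> \<rho>)"
      unfolding rank_covering_radius_def using that by (simp add: Min_le_iff)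
    then show ?thesis by (auto simp: rank_ball_def)
  qed
  have "rank_dist \<iota> x x \<le> \<rho>" for x :: "'a ^ 'n"
    using rk_le_card_support[of "{}" "0 :: 'a ^ 'n"] by (simp add: rank_dist_def)
  then have "(\<Union>c\<in>UNIV :: ('a ^ 'n) set. rank_ball \<iota> c \<rho>) = UNIV" by (auto simp: rank_ball_def)
  \<comment> \<open>The whole space covers itself, so the minimum is over a nonempty set.\<close>
  then have "CARD('a ^ 'n) \<in> ?X" using rad[of UNIV] by blast
  moreover have "finite ?X" by (rule finite_subset[of _ "card ` UNIV"]) auto
  ultimately have "Min ?X \<in> ?X" using Min_in[of ?X] by blast
  then obtain C :: "('a ^ 'n) set" where
    C: "Min ?X = card C" "C \<noteq> {}" "rank_covering_radius \<iota> C \<le> \<rho>"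
    by auto
  then show thesis
    using that[of C] rad[of C] by (simp add: rank_covering_number_def)
qed

end

theorem proposition7:
  fixes \<iota> :: "'k::{field, finite} \<Rightarrow> 'a::{field, finite}"
    and q m n \<rho> l :: nat
  defines "v \<equiv> ball_vol \<iota> TYPE('n::finite)"
    and "I \<equiv> ball_inter_vol \<iota> TYPE('n)"
    and "K \<equiv> rank_covering_number \<iota> TYPE('n)"
  assumes "primepow q" and "CARD('k) = q" and "CARD('a) = q ^ m"
    and "field_embedding \<iota>"
    and "CARD('n) = n"
    and "0 < \<rho>" and "\<rho> < n" and "n \<le> m"
    and "int l \<le> \<lfloor>log (real (q ^ m)) (real (K \<rho>))\<rfloor>"
  shows "real (K \<rho>) \<ge>
    (real q ^ (m * n) - real q ^ (l * m) * real (I \<rho> (n - l))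
       + (\<Sum>a = max 1 (n + 1 - 2 * \<rho>)..l.
            (real q ^ (a * m) - real q ^ ((a - 1) * m)) * real (I \<rho> (n - a + 1))))
    / (real (v \<rho>) - real (I \<rho> (n - l)))"
proof -
  interpret rank_metric \<iota> using assms by unfold_locales
  define Q where "Q = q ^ m"
  have q: "1 < q" using \<open>primepow q\<close> primepow_gt_Suc_0[of q] by simp
  then have Q: "1 < Q" using \<open>\<rho> < n\<close> \<open>n \<le> m\<close> unfolding Q_def by (intro one_less_power) auto
  have CQ: "CARD('a) = Q" using \<open>CARD('a) = q ^ m\<close> Q_def by simp
  have "q ^ m \<le> q ^ V.dim UNIV"
    using card_le_card_power_dim \<open>CARD('k) = q\<close> \<open>CARD('a) = q ^ m\<close> by simp
  then have "m \<le> V.dim UNIV" using q by simp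
  then have dim: "CARD('n) \<le> V.dim UNIV" using \<open>n \<le> m\<close> \<open>CARD('n) = n\<close> by simp
  obtain C :: "('a ^ 'n) set" where
    C: "card C = K \<rho>" "(\<Union>c\<in>C. rank_ball \<iota> c \<rho>) = UNIV"
    unfolding K_def by (rule rank_covering_number_attained)
  have cardV: "CARD('a ^ 'n) = Q ^ n" using CQ \<open>CARD('n) = n\<close> by simp
  have "C \<noteq> {}" using C(2) by auto
  then have "0 < K \<rho>" using C(1) by (metis card_gt_0_iff finite)
  moreover have "real l \<le> log (real Q) (real (K \<rho>))"
    using assms(12) by (simp add: le_floor_iff Q_def)
  ultimately have "real Q ^ l \<le> real (K \<rho>)"
    using Q by (simp add: le_log_iff powr_realpow)
  then have Ql: "Q ^ l \<le> K \<rho>" by (metis of_nat_le_iff of_nat_power)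
  \<comment> \<open>A code has at most \<open>Q ^ n\<close> words, which forces
    \<open>l \<le> n\<close> and makes \<open>n - l\<close> a genuine difference.\<close>
  have "K \<rho> \<le> Q ^ n" using C(1) cardV card_mono[of UNIV C] by simp
  then have "Q ^ l \<le> Q ^ n" using Ql by simp
  then have l: "l \<le> n" using Q by simp
  define t where "t = K \<rho> - Q ^ l"
  let ?L = "\<Sum>a = 1..l. (Q ^ a - Q ^ (a - 1)) * I \<rho> (n - a + 1)"
  let ?M = "\<Sum>a = max 1 (n + 1 - 2 * \<rho>)..l.
            (real q ^ (a * m) - real q ^ ((a - 1) * m)) * real (I \<rho> (n - a + 1))"
  have "Q ^ n + (?L + t * I \<rho> (n - l)) \<le> K \<rho> * v \<rho>"
    using card_UN_rank_ball_le[of C l t \<rho>] C Ql l dim \<open>CARD('n) = n\<close>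
    unfolding CQ t_def I_def v_def cardV by (simp add: CQ)
  then have "real Q ^ n + real ?L + real t * real (I \<rho> (n - l)) \<le> real (K \<rho>) * real (v \<rho>)"
    by (metis (no_types, lifting) add.assoc of_nat_add of_nat_le_iff of_nat_mult of_nat_power)
  moreover have "real t = real (K \<rho>) - real Q ^ l"
    using Ql unfolding t_def by (simp only: of_nat_diff of_nat_power)
  ultimately have bound: "real Q ^ n + real ?L + (real (K \<rho>) - real Q ^ l) * real (I \<rho> (n - l))
      \<le> real (K \<rho>) * real (v \<rho>)"
    by simp
  have summand: "(real q ^ (a * m) - real q ^ ((a - 1) * m)) * real (I \<rho> (n - a + 1))
      = real ((Q ^ a - Q ^ (a - 1)) * I \<rho> (n - a + 1))" for a
  proof -
    have "Q ^ (a - 1) \<le> Q ^ a" using Q by (intro power_increasing) auto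
    then show ?thesis by (simp add: of_nat_diff Q_def mult.commute flip: power_mult)
  qed
  \<comment> \<open>\<open>?M\<close> omits the terms of \<open>?L\<close> with small
    \<open>a\<close>; all terms are nonnegative.\<close>
  have "?M \<le> real ?L"
    unfolding summand of_nat_sum by (rule sum_mono2) auto
  moreover have "real q ^ (m * n) = real Q ^ n" "real q ^ (l * m) = real Q ^ l"
    by (simp_all add: Q_def mult.commute flip: power_mult)
  ultimately have "real q ^ (m * n) - real q ^ (l * m) * real (I \<rho> (n - l)) + ?M
      \<le> real (K \<rho>) * (real (v \<rho>) - real (I \<rho> (n - l)))"
    using bound by (simp add: algebra_simps)
  moreover have "I \<rho> (n - l) \<le> v \<rho>"
  proof -
    \<comment> \<open>A vector of rank \<open>n - l\<close> exhibits \<open>I \<rho> (n - l)\<close>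
      as the size of a subset of a ball, so the denominator is nonnegative.\<close>
    obtain z :: "'a ^ 'n" where "rk \<iota> z = n - l"
      using exists_rk_eq[OF _ dim, of "n - l"] \<open>CARD('n) = n\<close> by auto
    then have "I \<rho> (n - l) = card (rank_ball \<iota> 0 \<rho> \<inter> rank_ball \<iota> z \<rho>)"
      unfolding I_def card_rank_ball_inter by (metis ball_inter_vol_eq diff_zero)
    also have "\<dots> \<le> card (rank_ball \<iota> (0 :: 'a ^ 'n) \<rho>)" by (intro card_mono) auto
    finally show ?thesis by (simp add: v_def card_rank_ball)
  qed
  \<comment> \<open>If the denominator is zero, the quotient is \<open>0\<close> by convention and
    the bound is trivial.\<close>
  ultimately show ?thesis
    by (cases "I \<rho> (n - l) = v \<rho>") (auto simp: divide_le_eq)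
qed

end
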